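(* Let $m,n\ge 1$ be integers, $a>0$ and $q>0$, and consider the directed grid $G_{m,n}$ with source $s=(0,0)$, sink $t=(m,n)$ and demand $q$. For a chord $u\to v$ and $b,c,d\ge0$, let $BR(u\to v;b,c,d)$ be the Braess Ratio when every grid edge has latency $ax+b$ and the chord has latency $cx+d$. Suppose the grid is capable of Braess' Paradox, i.e. $BR(u\to v;b,c,d)>1$ for some chord $u\to v$ and some $b,c,d\ge0$. If a chord $u\to v$ with coefficients $b,c,d\ge 0$ maximizes the Braess Ratio over all chords and all nonnegative coefficients, then the chord has zero latency, that is, \[ c=d=0 . \]
   Context: Grid: $G_{m,n}=(V,E)$ is the directed graph with vertex set $V=\{0,\dots,m\}\times\{0,\dots,n\}$ and directed edges $(i,j)\to(i+1,j)$ for $i<m$ and $(i,j)\to(i,j+1)$ for $j<n$. Chord: an added directed edge $u\to v$ with $u,v\in V$, $u\ne v$, such that $uv$ is not an edge of the underlying undirected grid. Feasible flow (in the grid, or in the grid plus chord): a nonnegative number $f_e$ for each directed edge $e$, with flow conserved at every vertex other than $s,t$, and net outflow from $s$ and net inflow to $t$ both equal to $q$. Its cost is $C(f)=\sum_e f_e\ell_e(f_e)$, where $\ell_e$ is the latency function of $e$. User Equilibrium: a feasible flow, decomposable into flows along $s$-$t$ paths, such that every path carrying positive flow has latency (sum of $\ell_e(f_e)$ over its edges) no larger than that of any other $s$-$t$ path. By a classical theorem (Beckmann, McGuire, Winsten) these are exactly the minimizers over feasible flows of the Beckmann potential $Z(f)=\sum_e\int_0^{f_e}\ell_e(y)\,dy$;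 in the networks considered here the minimizer is unique. Braess Ratio: $BR=C_{\mathrm{new}}/C_{\mathrm{old}}$, where $C_{\mathrm{old}}$ is the cost of the User Equilibrium of $G_{m,n}$ and $C_{\mathrm{new}}$ is the cost of the User Equilibrium of $G_{m,n}$ with the chord added (same $s,t,q$). Braess' Paradox means $BR>1$. *)

theory Defs
  imports Complex_Main "Graph_Theory.Arc_Walk"
begin

type_synonym vertex = "nat \<times> nat"

type_synonym edge = "vertex \<times> vertex"

definition grid :: "nat \<Rightarrow> nat \<Rightarrow> (vertex, edge) pre_digraph" where
  "grid m n =
     \<lparr> verts = {0..m} \<times> {0..n},
       arcs = {((i, j), (i + 1, j)) | i j. i < m \<and> j \<le> n} \<union>
              {((i, j), (i, j + 1)) | i j. i \<le> m \<and> j < n},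
       tail = fst, head = snd \<rparr>"

definition is_chord :: "nat \<Rightarrow> nat \<Rightarrow> vertex \<Rightarrow> vertex \<Rightarrow> bool" where
  "is_chord m n u v \<longleftrightarrow>
     u \<in> verts (grid m n) \<and> v \<in> verts (grid m n) \<and> u \<noteq> v \<and>
     (u, v) \<notin> arcs (grid m n) \<and> (v, u) \<notin> arcs (grid m n)"

definition net_outflow ::
    "('v, 'e) pre_digraph \<Rightarrow> ('e \<Rightarrow> real) \<Rightarrow> 'v \<Rightarrow> real" where
  "net_outflow G f w = (\<Sum>e\<in>out_arcs G w. f e) - (\<Sum>e\<in>in_arcs G w. f e)"

text \<open>
  A flow is a total function on the type of arcs; requiring it to vanish off the arcs of the
  graph makes two flows equal exactly when they agree on every arc.
\<close>
definition feasible_flow ::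
    "('v, 'e) pre_digraph \<Rightarrow> 'v \<Rightarrow> 'v \<Rightarrow> real \<Rightarrow> ('e \<Rightarrow> real) \<Rightarrow> bool" where
  "feasible_flow G s t q f \<longleftrightarrow>
     (\<forall>e\<in>arcs G. 0 \<le> f e) \<and> (\<forall>e. e \<notin> arcs G \<longrightarrow> f e = 0) \<and>
     (\<forall>w\<in>verts G - {s, t}. net_outflow G f w = 0) \<and>
     net_outflow G f s = q \<and> net_outflow G f t = - q"

definition flow_cost ::
    "('v, 'e) pre_digraph \<Rightarrow> ('e \<Rightarrow> real \<Rightarrow> real) \<Rightarrow> ('e \<Rightarrow> real) \<Rightarrow> real" where
  "flow_cost G l f = (\<Sum>e\<in>arcs G. f e * l e (f e))"

definition st_paths :: "('v, 'e) pre_digraph \<Rightarrow> 'v \<Rightarrow> 'v \<Rightarrow> 'e awalk set" where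
  "st_paths G s t = {p. pre_digraph.apath G s p t}"

definition path_latency ::
    "('e \<Rightarrow> real \<Rightarrow> real) \<Rightarrow> ('e \<Rightarrow> real) \<Rightarrow> 'e awalk \<Rightarrow> real" where
  "path_latency l f p = (\<Sum>e\<leftarrow>p. l e (f e))"

text \<open>
  The function \<open>h\<close> is the path decomposition of \<open>f\<close>: \<open>h p\<close> is the amount of flow sent along
  the path \<open>p\<close>.
\<close>
definition is_user_equilibrium ::
    "('v, 'e) pre_digraph \<Rightarrow> ('e \<Rightarrow> real \<Rightarrow> real) \<Rightarrow> 'v \<Rightarrow> 'v \<Rightarrow> real \<Rightarrow> ('e \<Rightarrow> real) \<Rightarrow> bool" where
  "is_user_equilibrium G l s t q f \<longleftrightarrow>
     feasible_flow G s t q f \<and>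
     (\<exists>h :: 'e awalk \<Rightarrow> real.
        (\<forall>p\<in>st_paths G s t. 0 \<le> h p) \<and>
        (\<forall>e\<in>arcs G. f e = (\<Sum>p\<in>{p \<in> st_paths G s t. e \<in> set p}. h p)) \<and>
        (\<forall>p\<in>st_paths G s t. \<forall>p'\<in>st_paths G s t.
           0 < h p \<longrightarrow> path_latency l f p \<le> path_latency l f p'))"

text \<open>
  Existence and uniqueness of the equilibrium hold for the networks below whenever
  \<open>a > 0\<close>, \<open>q \<ge> 0\<close> and \<open>b, c, d \<ge> 0\<close>.
\<close>
definition user_equilibrium ::
    "('v, 'e) pre_digraph \<Rightarrow> ('e \<Rightarrow> real \<Rightarrow> real) \<Rightarrow> 'v \<Rightarrow> 'v \<Rightarrow> real \<Rightarrow> ('e \<Rightarrow> real)" where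
  "user_equilibrium G l s t q = (THE f. is_user_equilibrium G l s t q f)"

definition equilibrium_cost ::
    "('v, 'e) pre_digraph \<Rightarrow> ('e \<Rightarrow> real \<Rightarrow> real) \<Rightarrow> 'v \<Rightarrow> 'v \<Rightarrow> real \<Rightarrow> real" where
  "equilibrium_cost G l s t q = flow_cost G l (user_equilibrium G l s t q)"

definition grid_latency :: "real \<Rightarrow> real \<Rightarrow> edge \<Rightarrow> real \<Rightarrow> real" where
  "grid_latency a b e x = a * x + b"

definition chord_latency ::
    "vertex \<Rightarrow> vertex \<Rightarrow> real \<Rightarrow> real \<Rightarrow> real \<Rightarrow> real \<Rightarrow> edge \<Rightarrow> real \<Rightarrow> real" where
  "chord_latency u v a b c d e x = (if e = (u, v) then c * x + d else grid_latency a b e x)"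

definition braess_ratio ::
    "nat \<Rightarrow> nat \<Rightarrow> real \<Rightarrow> real \<Rightarrow> vertex \<Rightarrow> vertex \<Rightarrow> real \<Rightarrow> real \<Rightarrow> real \<Rightarrow> real" where
  "braess_ratio m n a q u v b c d =
     equilibrium_cost (pre_digraph.add_arc (grid m n) (u, v)) (chord_latency u v a b c d)
       (0, 0) (m, n) q /
     equilibrium_cost (grid m n) (grid_latency a b) (0, 0) (m, n) q"

end

theory Submission
  imports Defs "Graph_Theory.Digraph_Component" "HOL-Analysis.Function_Topology"
begin

text \<open>
  Let \<open>\<phi>(i, j) = i + j\<close>. Subtracting \<open>\<delta> (\<phi>(head e) - \<phi>(tail e))\<close> from the latency of every arc
  \<open>e\<close> changes the latency of every \<open>s\<close>-\<open>t\<close> path by the same constant \<open>\<delta> (m + n)\<close>, so it keeps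
  equilibria. On grid arcs this lowers \<open>b\<close> by \<open>\<delta>\<close>; on a chord advancing by \<open>L\<close> and carrying
  \<open>x\<close> it removes \<open>\<delta> L\<close>. A variational argument shows that a ratio above \<open>1\<close> forces \<open>x > 0\<close>
  and \<open>c x + d < b L\<close>. Hence \<open>\<delta> = (c x + d) / L\<close> is smaller than \<open>b\<close>, and a chord of zero latency
  with grid coefficient \<open>b - \<delta>\<close> has the same equilibria. Both costs drop by \<open>q \<delta> (m + n)\<close>, which
  strictly increases a ratio above \<open>1\<close> unless \<open>c x + d = 0\<close>.
\<close>

section \<open>Path flows\<close>

text \<open>The arc flow induced by path amounts \<open>h\<close>. The sum has the shape used in
  \<open>is_user_equilibrium\<close>, so a path decomposition of \<open>f\<close> becomes the
  equation \<open>f = path_flow G s t h\<close>.\<close>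

definition path_flow ::
    "('v, 'e) pre_digraph \<Rightarrow> 'v \<Rightarrow> 'v \<Rightarrow> ('e awalk \<Rightarrow> real) \<Rightarrow> 'e \<Rightarrow> real" where
  "path_flow G s t h e = (\<Sum>p\<in>{p \<in> st_paths G s t. e \<in> set p}. h p)"

lemma (in wf_digraph) awalk_telescope:
  fixes \<phi> :: "'a \<Rightarrow> real"
  assumes "awalk x p y"
  shows "(\<Sum>e\<leftarrow>p. \<phi> (head G e) - \<phi> (tail G e)) = \<phi> y - \<phi> x"
  using assms by (induction p arbitrary: x) (auto simp: awalk_Nil_iff awalk_Cons_iff)

context fin_digraph
begin

lemma finite_st_paths [simp]: "finite (st_paths G s t)"
  unfolding st_paths_def by (rule apaths_finite)

lemma st_path_telescope:
  fixes \<phi> :: "'a \<Rightarrow> real"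
  assumes "p \<in> st_paths G s t"
  shows "(\<Sum>e\<leftarrow>p. \<phi> (head G e) - \<phi> (tail G e)) = \<phi> t - \<phi> s"
  using assms awalk_telescope by (auto simp: st_paths_def apath_def)

text \<open>An \<open>apath\<close> repeats no vertex and hence no arc, so a sum along it is a sum
  over all arcs weighted by membership. In this form sums over arcs and over paths can be
  interchanged.\<close>

lemma st_path_sum_list:
  fixes g :: "'b \<Rightarrow> real"
  assumes "p \<in> st_paths G s t"
  shows "(\<Sum>e\<leftarrow>p. g e) = (\<Sum>e\<in>arcs G. of_bool (e \<in> set p) * g e)"
proof -
  have p: "awalk s p t" "distinct (awalk_verts s p)"
    using assms by (auto simp: st_paths_def apath_def)
  then have "distinct p" by (rule distinct_verts_imp_distinct)
  moreover have "set p \<subseteq> arcs G" using p by (auto simp: awalk_def)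
  ultimately have "(\<Sum>e\<leftarrow>p. g e) = (\<Sum>e\<in>set p. g e)"
    by (simp add: sum_list_distinct_conv_sum_set)
  also have "\<dots> = (\<Sum>e\<in>arcs G. of_bool (e \<in> set p) * g e)"
    using \<open>set p \<subseteq> arcs G\<close> by (intro sum.mono_neutral_cong_left) auto
  finally show ?thesis .
qed

lemma path_flow_altdef:
  "path_flow G s t h e = (\<Sum>p\<in>st_paths G s t. h p * of_bool (e \<in> set p))"
  unfolding path_flow_def by (rule sum.mono_neutral_cong_left) auto

lemma path_flow_eq_0: "e \<notin> arcs G \<Longrightarrow> path_flow G s t h e = 0"
  unfolding path_flow_def
  by (rule sum.neutral) (auto simp: st_paths_def apath_def awalk_def)

text \<open>Double counting: each path contributes its amount once for every arc on it. This
  converts arc-based totals such as the cost into weighted path sums.\<close>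

lemma sum_path_flow_mult:
  "(\<Sum>e\<in>arcs G. path_flow G s t h e * g e) = (\<Sum>p\<in>st_paths G s t. h p * (\<Sum>e\<leftarrow>p. g e))"
proof -
  have "(\<Sum>e\<in>arcs G. path_flow G s t h e * g e) =
      (\<Sum>e\<in>arcs G. \<Sum>p\<in>st_paths G s t. h p * (of_bool (e \<in> set p) * g e))"
    by (simp only: path_flow_altdef sum_distrib_right mult.assoc)
  also have "\<dots> = (\<Sum>p\<in>st_paths G s t. \<Sum>e\<in>arcs G. h p * (of_bool (e \<in> set p) * g e))"
    by (rule sum.swap)
  also have "\<dots> = (\<Sum>p\<in>st_paths G s t. h p * (\<Sum>e\<leftarrow>p. g e))"
    by (intro sum.cong refl) (simp only: st_path_sum_list sum_distrib_left)
  finally show ?thesis .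
qed

lemma net_outflow_altdef:
  "net_outflow G f w = (\<Sum>e\<in>arcs G. f e * (of_bool (tail G e = w) - of_bool (head G e = w)))"
proof -
  have "(\<Sum>e\<in>out_arcs G w. f e) = (\<Sum>e\<in>arcs G. f e * of_bool (tail G e = w))"
    by (rule sum.mono_neutral_cong_left) auto
  moreover have "(\<Sum>e\<in>in_arcs G w. f e) = (\<Sum>e\<in>arcs G. f e * of_bool (head G e = w))"
    by (rule sum.mono_neutral_cong_left) auto
  ultimately show ?thesis
    by (simp add: net_outflow_def right_diff_distrib sum_subtractf)
qed

lemma net_outflow_path_flow:
  "net_outflow G (path_flow G s t h) w =
     (\<Sum>p\<in>st_paths G s t. h p) * (of_bool (s = w) - of_bool (t = w))"
proof -
  have "(\<Sum>e\<leftarrow>p. of_bool (tail G e = w) - of_bool (head G e = w)) =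
      (of_bool (s = w) - of_bool (t = w) :: real)" if "p \<in> st_paths G s t" for p
    \<comment> \<open>The signed incidence with \<open>w\<close> is the increment of the potential
      that is -1 at \<open>w\<close> and 0 elsewhere, so it telescopes along the path.\<close>
    using st_path_telescope[OF that, of "\<lambda>x. - of_bool (x = w)"]
    by (simp add: algebra_simps)
  then show ?thesis
    by (simp add: net_outflow_altdef sum_path_flow_mult sum_distrib_right)
qed

lemma feasible_path_flow:
  assumes "s \<noteq> t" and "\<forall>p\<in>st_paths G s t. 0 \<le> h p" and "(\<Sum>p\<in>st_paths G s t. h p) = q"
  shows "feasible_flow G s t q (path_flow G s t h)"
  using assms unfolding feasible_flow_def
  by (auto simp: net_outflow_path_flow path_flow_eq_0) (auto simp: path_flow_def intro: sum_nonneg)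

section \<open>User equilibria\<close>

text \<open>The cost is the \<open>h\<close>-weighted sum of path latencies. Paths with positive
  weight have least latency, so no path has latency below cost divided by \<open>q\<close>.\<close>

lemma user_equilibriumE:
  assumes "is_user_equilibrium G l s t q f" and "s \<noteq> t" and "0 < q"
  obtains h where "f = path_flow G s t h"
    and "\<forall>p\<in>st_paths G s t. 0 \<le> h p" and "(\<Sum>p\<in>st_paths G s t. h p) = q"
    and "\<And>p. p \<in> st_paths G s t \<Longrightarrow> (\<Sum>e\<in>arcs G. f e * l e (f e)) \<le> q * path_latency l f p"
proof -
  obtain h where h: "\<forall>p\<in>st_paths G s t. 0 \<le> h p"
      "\<forall>e\<in>arcs G. f e = (\<Sum>p\<in>{p \<in> st_paths G s t. e \<in> set p}. h p)"
      "\<forall>p\<in>st_paths G s t. \<forall>p'\<in>st_paths G s t.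
         0 < h p \<longrightarrow> path_latency l f p \<le> path_latency l f p'"
    and ff: "feasible_flow G s t q f"
    using assms(1) unfolding is_user_equilibrium_def by blast
  have f: "f = path_flow G s t h"
  proof
    fix e
    show "f e = path_flow G s t h e"
      using h(2) ff path_flow_eq_0[of e]
      by (cases "e \<in> arcs G") (auto simp: path_flow_def feasible_flow_def)
  qed
  have "net_outflow G f s = q" using ff by (simp add: feasible_flow_def)
  then have total: "(\<Sum>p\<in>st_paths G s t. h p) = q"
    using \<open>s \<noteq> t\<close> by (simp add: f net_outflow_path_flow)
  have "(\<Sum>e\<in>arcs G. f e * l e (f e)) \<le> q * path_latency l f p'" if p': "p' \<in> st_paths G s t" for p'
  proof -
    have "(\<Sum>e\<in>arcs G. f e * l e (f e)) = (\<Sum>p\<in>st_paths G s t. h p * path_latency l f p)"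
      using sum_path_flow_mult[of s t h "\<lambda>e. l e (f e)"] by (simp add: path_latency_def flip: f)
    also have "\<dots> \<le> (\<Sum>p\<in>st_paths G s t. h p * path_latency l f p')"
    proof (rule sum_mono)
      fix p assume p: "p \<in> st_paths G s t"
      show "h p * path_latency l f p \<le> h p * path_latency l f p'"
        using h(1,3) p p' by (cases "h p = 0") (auto intro!: mult_left_mono simp: less_le)
    qed
    also have "\<dots> = q * path_latency l f p'"
      by (simp add: total flip: sum_distrib_right)
    finally show ?thesis .
  qed
  with that f h(1) total show thesis by blast
qed

lemma user_equilibrium_potential:
  fixes \<phi> :: "'a \<Rightarrow> real"
  assumes "is_user_equilibrium G l s t q f" and "s \<noteq> t" and "0 < q"
  shows "(\<Sum>e\<in>arcs G. f e * (\<phi> (head G e) - \<phi> (tail G e))) = q * (\<phi> t - \<phi> s)"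
  using assms
  by (elim user_equilibriumE) (simp_all add: sum_path_flow_mult st_path_telescope flip: sum_distrib_right)

text \<open>All path latencies change by one common constant, so their order is kept. The latencies
  are compared only at the values \<open>f e\<close>; a chord with different coefficients can
  therefore take over the same equilibrium.\<close>

lemma user_equilibrium_shift:
  fixes \<phi> :: "'a \<Rightarrow> real"
  assumes ue: "is_user_equilibrium G l s t q f"
    and l': "\<And>e. e \<in> arcs G \<Longrightarrow> l' e (f e) = l e (f e) - \<delta> * (\<phi> (head G e) - \<phi> (tail G e))"
  shows "is_user_equilibrium G l' s t q f"
proof -
  have "path_latency l' f p = path_latency l f p - \<delta> * (\<phi> t - \<phi> s)" if "p \<in> st_paths G s t" for p
    unfolding path_latency_def st_path_telescope[OF that, of \<phi>, symmetric]
      st_path_sum_list[OF that] sum_distrib_left sum_subtractf[symmetric]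
    by (intro sum.cong refl) (simp add: l' algebra_simps)
  then show ?thesis
    using ue unfolding is_user_equilibrium_def by force
qed

lemma flow_cost_shift:
  fixes \<phi> :: "'a \<Rightarrow> real"
  assumes ue: "is_user_equilibrium G l s t q f" and "s \<noteq> t" and "0 < q"
    and l': "\<And>e. e \<in> arcs G \<Longrightarrow> l' e (f e) = l e (f e) - \<delta> * (\<phi> (head G e) - \<phi> (tail G e))"
  shows "flow_cost G l' f = flow_cost G l f - \<delta> * (q * (\<phi> t - \<phi> s))"
  unfolding flow_cost_def user_equilibrium_potential[OF ue assms(2,3), of \<phi>, symmetric]
    sum_distrib_left sum_subtractf[symmetric]
  by (intro sum.cong refl) (simp add: l' algebra_simps)

end

text \<open>Every path used by \<open>g\<close> is also a path of \<open>G\<close>, so its latency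
  under \<open>f\<close> is at least the cost of \<open>f\<close> divided by \<open>q\<close>;
  average this over the path amounts of \<open>g\<close>. Taking \<open>K = G\<close> serves
  uniqueness, taking the bare grid for \<open>K\<close> serves the comparison with the old
  flow.\<close>

lemma user_equilibrium_variational:
  assumes "fin_digraph G" and "fin_digraph K" and "st_paths K s t \<subseteq> st_paths G s t"
    and "s \<noteq> t" and "0 < q"
    and f: "is_user_equilibrium G l s t q f" and g: "is_user_equilibrium K l' s t q g"
  shows "flow_cost G l f \<le> (\<Sum>e\<in>arcs K. g e * l e (f e))"
proof -
  interpret G: fin_digraph G by fact
  interpret K: fin_digraph K by fact
  obtain h where h: "g = path_flow K s t h" "\<forall>p\<in>st_paths K s t. 0 \<le> h p"
      "(\<Sum>p\<in>st_paths K s t. h p) = q"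
    using K.user_equilibriumE[OF g assms(4,5)] by metis
  have le: "flow_cost G l f \<le> q * path_latency l f p" if "p \<in> st_paths G s t" for p
    unfolding flow_cost_def by (rule G.user_equilibriumE[OF f assms(4,5)]) (use that in blast)
  have "q * flow_cost G l f = (\<Sum>p\<in>st_paths K s t. h p * flow_cost G l f)"
    by (simp add: h(3) flip: sum_distrib_right)
  also have "\<dots> \<le> (\<Sum>p\<in>st_paths K s t. h p * (q * path_latency l f p))"
    using le h(2) assms(3) by (intro sum_mono mult_left_mono) auto
  also have "\<dots> = q * (\<Sum>e\<in>arcs K. g e * l e (f e))"
    by (simp add: h(1) K.sum_path_flow_mult path_latency_def sum_distrib_left mult.left_commute)
  finally show ?thesis using \<open>0 < q\<close> by simp
qed

section \<open>Existence and uniqueness for affine latencies\<close>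

context fin_digraph
begin

text \<open>
  At most one arc \<open>k\<close> may have constant latency; its flow is determined by conservation
  at its tail.
\<close>
lemma user_equilibrium_unique:
  assumes l: "\<And>e x. e \<in> arcs G \<Longrightarrow> l e x = \<alpha> e * x + \<beta> e"
    and pos: "\<And>e. e \<in> arcs G \<Longrightarrow> e \<noteq> k \<Longrightarrow> 0 < \<alpha> e"
    and k: "k \<in> arcs G \<Longrightarrow> 0 \<le> \<alpha> k" "tail G k \<noteq> head G k"
    and "s \<noteq> t" and "0 < q"
    and f: "is_user_equilibrium G l s t q f" and g: "is_user_equilibrium G l s t q g"
  shows "f = g"
proof
  fix e
  have nonneg: "0 \<le> \<alpha> e" if "e \<in> arcs G" for e
    using that pos[of e] k(1) by (cases "e = k") auto
  have "(\<Sum>e\<in>arcs G. f e * l e (f e)) \<le> (\<Sum>e\<in>arcs G. g e * l e (f e))"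
    "(\<Sum>e\<in>arcs G. g e * l e (g e)) \<le> (\<Sum>e\<in>arcs G. f e * l e (g e))"
    using user_equilibrium_variational[of G G s t q l f l g]
      user_equilibrium_variational[of G G s t q l g l f] fin_digraph_axioms assms
    by (auto simp: flow_cost_def)
  \<comment> \<open>Adding the two variational inequalities leaves a weighted sum of squares that is
    at most zero.\<close>
  moreover have "(\<Sum>e\<in>arcs G. \<alpha> e * (f e - g e)\<^sup>2) =
      (\<Sum>e\<in>arcs G. f e * l e (f e)) - (\<Sum>e\<in>arcs G. g e * l e (f e)) +
      ((\<Sum>e\<in>arcs G. g e * l e (g e)) - (\<Sum>e\<in>arcs G. f e * l e (g e)))"
    unfolding sum_subtractf[symmetric] sum.distrib[symmetric]
    by (rule sum.cong) (auto simp: l power2_eq_square algebra_simps)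
  ultimately have "(\<Sum>e\<in>arcs G. \<alpha> e * (f e - g e)\<^sup>2) \<le> 0" by linarith
  then have "(\<Sum>e\<in>arcs G. \<alpha> e * (f e - g e)\<^sup>2) = 0"
    using nonneg by (intro antisym sum_nonneg) auto
  then have "\<forall>e\<in>arcs G. \<alpha> e * (f e - g e)\<^sup>2 = 0"
    using nonneg by (subst (asm) sum_nonneg_eq_0_iff) auto
  then have eq: "f e = g e" if "e \<in> arcs G" "e \<noteq> k" for e
    using that pos[of e] by auto
  show "f e = g e"
  proof (cases "e \<in> arcs G")
    case False
    then show ?thesis using f g by (simp add: is_user_equilibrium_def feasible_flow_def)
  next
    case True
    show ?thesis
    proof (cases "e = k")
      case [simp]: True
      have "net_outflow G f (tail G k) = net_outflow G g (tail G k)"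
        using f g tail_in_verts[OF \<open>e \<in> arcs G\<close>]
        unfolding is_user_equilibrium_def feasible_flow_def
        by (cases "tail G k \<in> {s, t}") auto
      then have "0 = (\<Sum>e\<in>arcs G. (f e - g e) *
          (of_bool (tail G e = tail G k) - of_bool (head G e = tail G k)))"
        by (simp add: net_outflow_altdef left_diff_distrib sum_subtractf)
      \<comment> \<open>Both flows have the same net outflow at the tail of \<open>k\<close> and
        agree on all other arcs, so only the term of \<open>k\<close> survives. Its incidence is
        nonzero because the ends of \<open>k\<close> differ.\<close>
      also have "\<dots> = (\<Sum>e\<in>{k}. (f e - g e) *
          (of_bool (tail G e = tail G k) - of_bool (head G e = tail G k)))"
        using eq \<open>e \<in> arcs G\<close> by (intro sum.mono_neutral_right) auto
      finally show ?thesis using k(2) by auto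
    qed (use eq True in auto)
  qed
qed

text \<open>Requiring \<open>h\<close> to vanish off \<open>P\<close> places the simplex in a
  product of intervals and singletons, compact by Tychonoff's theorem; the condition on the sum is
  closed.\<close>

lemma compact_path_simplex:
  assumes "finite P"
  shows "compact {h :: 'c \<Rightarrow> real. (\<forall>p\<in>P. 0 \<le> h p) \<and> (\<forall>p. p \<notin> P \<longrightarrow> h p = 0) \<and> sum h P = q}"
    (is "compact ?S")
proof -
  let ?K = "\<lambda>p. if p \<in> P then {0..q} else {0::real}"
  have "compactin (product_topology (\<lambda>_. euclidean) UNIV) (Pi\<^sub>E UNIV ?K)"
    by (subst compactin_PiE) (auto simp: compactin_euclidean_iff)
  then have "compact (Pi\<^sub>E UNIV ?K)"
    by (simp add: euclidean_product_topology compactin_euclidean_iff)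
  moreover have "closed {h :: 'c \<Rightarrow> real. sum h P = q}"
    by (intro closed_Collect_eq continuous_on_sum continuous_on_product_coordinates
        continuous_on_const)
  moreover have "?S = Pi\<^sub>E UNIV ?K \<inter> {h. sum h P = q}"
  proof (intro set_eqI iffI)
    fix h assume "h \<in> ?S"
    then show "h \<in> Pi\<^sub>E UNIV ?K \<inter> {h. sum h P = q}"
      using member_le_sum[of _ P h] assms by (auto simp: PiE_iff)
  next
    fix h assume "h \<in> Pi\<^sub>E UNIV ?K \<inter> {h. sum h P = q}"
    then have K: "h p \<in> ?K p" and total: "sum h P = q" for p by (auto simp: PiE_iff)
    have "0 \<le> h p" if "p \<in> P" for p using K[of p] that by simp
    moreover have "h p = 0" if "p \<notin> P" for p using K[of p] that by simp
    ultimately show "h \<in> ?S" using total by simp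
  qed
  ultimately show ?thesis by (simp add: compact_Int_closed)
qed

text \<open>The equilibrium is a minimizer of the Beckmann potential over the path flows.\<close>
lemma user_equilibrium_exists:
  assumes l: "\<And>e x. e \<in> arcs G \<Longrightarrow> l e x = \<alpha> e * x + \<beta> e"
    and nonneg: "\<And>e. e \<in> arcs G \<Longrightarrow> 0 \<le> \<alpha> e"
    and "s \<noteq> t" and "0 < q" and "st_paths G s t \<noteq> {}"
  shows "\<exists>f. is_user_equilibrium G l s t q f"
proof -
  define P where "P = st_paths G s t"
  define S where "S = {h. (\<forall>p\<in>P. 0 \<le> h p) \<and> (\<forall>p. p \<notin> P \<longrightarrow> h p = 0) \<and> sum h P = q}"
  define F where "F = path_flow G s t"
  define Z where "Z h = (\<Sum>e\<in>arcs G. \<alpha> e * (F h e)\<^sup>2 / 2 + \<beta> e * F h e)" for h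
  have fin: "finite P" by (simp add: P_def)
  obtain p0 where "p0 \<in> P" using assms by (auto simp: P_def)
  then have "(\<lambda>p. if p = p0 then q else 0) \<in> S" using \<open>0 < q\<close> fin by (auto simp: S_def)
  then have "S \<noteq> {}" by blast
  moreover have "compact S" unfolding S_def using fin by (rule compact_path_simplex)
  moreover have "continuous_on S (\<lambda>h. F h e)" for e
    unfolding F_def path_flow_altdef
    by (intro continuous_on_sum continuous_on_mult continuous_on_const
        continuous_on_subset[OF continuous_on_product_coordinates subset_UNIV])
  then have "continuous_on S Z"
    unfolding Z_def divide_inverse
    by (intro continuous_on_sum continuous_on_add continuous_on_mult continuous_on_power
        continuous_on_const)
  ultimately obtain h where h: "h \<in> S" and min: "\<And>h'. h' \<in> S \<Longrightarrow> Z h \<le> Z h'"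
    by (metis continuous_attains_inf)
  have "path_latency l (F h) p \<le> path_latency l (F h) p'"
    if p: "p \<in> P" "p' \<in> P" "0 < h p" for p p'
  proof (rule ccontr)
    \<comment> \<open>Suppose \<open>p'\<close> is faster than the used path \<open>p\<close>, and
      move \<open>\<epsilon>\<close> units from \<open>p\<close> to \<open>p'\<close>.
      \<open>D\<close> is the first-order rate of change of \<open>Z\<close>, and \<open>M\<close>
      the coefficient of the quadratic term.\<close>
    define \<chi> where "\<chi> e = (of_bool (e \<in> set p') - of_bool (e \<in> set p) :: real)" for e
    define D where "D = path_latency l (F h) p' - path_latency l (F h) p"
    define M where "M = (\<Sum>e\<in>arcs G. \<alpha> e * (\<chi> e)\<^sup>2 / 2)"
    \<comment> \<open>The first bound keeps the amount on \<open>p\<close> nonnegative; the second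
      makes the linear gain exceed the quadratic loss. Using \<open>M + 1\<close> keeps the
      denominator positive when \<open>M = 0\<close>.\<close>
    define \<epsilon> where "\<epsilon> = min (h p) (- D / (M + 1))"
    define h' where "h' r = h r + \<epsilon> * (of_bool (r = p') - of_bool (r = p))" for r
    assume "\<not> path_latency l (F h) p \<le> path_latency l (F h) p'"
    then have "D < 0" by (simp add: D_def)
    have "0 \<le> M" unfolding M_def using nonneg by (intro sum_nonneg) auto
    have "0 < \<epsilon>" using \<open>D < 0\<close> \<open>0 \<le> M\<close> p(3) by (simp add: \<epsilon>_def divide_neg_pos)
    have "\<epsilon> * (M + 1) \<le> - D"
      using \<open>0 \<le> M\<close> by (simp add: \<epsilon>_def flip: pos_le_divide_eq)
    have "sum h' P = sum h P"
      using p fin by (simp add: h'_def sum.distrib sum_subtractf flip: sum_distrib_left)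
    moreover have "0 \<le> h' r" if "r \<in> P" for r
      using that h \<open>0 < \<epsilon>\<close> by (auto simp: h'_def S_def \<epsilon>_def)
    ultimately have "h' \<in> S" using h p by (auto simp: S_def h'_def)
    then have "Z h \<le> Z h'" by (rule min)
    have "F h' e = F h e + \<epsilon> * \<chi> e" for e
    proof -
      have "(\<Sum>r\<in>P. of_bool (r = x) * of_bool (e \<in> set r)) = (of_bool (e \<in> set x) :: real)"
        if "x \<in> P" for x
        using fin that by (simp add: sum.remove[of P x])
      then show ?thesis using p
        unfolding F_def path_flow_altdef P_def[symmetric] h'_def \<chi>_def
        by (simp add: distrib_right left_diff_distrib right_diff_distrib sum.distrib
            sum_subtractf mult.assoc flip: sum_distrib_left)
    qed
    \<comment> \<open>For affine latencies \<open>Z\<close> is quadratic, so this second-order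
      expansion is exact.\<close>
    then have "Z h' - Z h = (\<Sum>e\<in>arcs G.
        \<epsilon> * (\<chi> e * l e (F h e)) + \<epsilon> * \<epsilon> * (\<alpha> e * (\<chi> e)\<^sup>2 / 2))"
      unfolding Z_def sum_subtractf[symmetric]
      by (intro sum.cong) (auto simp: l power2_eq_square field_simps)
    also have "\<dots> = \<epsilon> * (\<Sum>e\<in>arcs G. \<chi> e * l e (F h e)) + \<epsilon> * \<epsilon> * M"
      by (simp add: M_def sum.distrib sum_distrib_left)
    also have "(\<Sum>e\<in>arcs G. \<chi> e * l e (F h e)) = D"
      using p unfolding D_def path_latency_def P_def \<chi>_def
      by (simp add: st_path_sum_list left_diff_distrib sum_subtractf)
    finally have "0 \<le> \<epsilon> * (D + \<epsilon> * M)"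
      using \<open>Z h \<le> Z h'\<close> by (simp add: algebra_simps)
    then have "0 \<le> D + \<epsilon> * M" using \<open>0 < \<epsilon>\<close> by (simp add: zero_le_mult_iff)
    with \<open>\<epsilon> * (M + 1) \<le> - D\<close> \<open>0 < \<epsilon>\<close> show False by (simp add: algebra_simps)
  qed
  moreover have "feasible_flow G s t q (F h)"
    using feasible_path_flow h \<open>s \<noteq> t\<close> by (auto simp: S_def P_def F_def)
  ultimately have "is_user_equilibrium G l s t q (F h)"
    using h unfolding is_user_equilibrium_def
    by (auto simp: S_def P_def F_def path_flow_def[abs_def] intro!: exI[of _ h])
  then show ?thesis by blast
qed

lemma user_equilibrium_eqI:
  assumes "\<And>e x. e \<in> arcs G \<Longrightarrow> l e x = \<alpha> e * x + \<beta> e"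
    and "\<And>e. e \<in> arcs G \<Longrightarrow> e \<noteq> k \<Longrightarrow> 0 < \<alpha> e"
    and "k \<in> arcs G \<Longrightarrow> 0 \<le> \<alpha> k" "tail G k \<noteq> head G k"
    and "s \<noteq> t" and "0 < q" and "is_user_equilibrium G l s t q f"
  shows "user_equilibrium G l s t q = f"
  unfolding user_equilibrium_def
  using assms user_equilibrium_unique[of l \<alpha> \<beta> k s t q] by (intro the_equality) blast+

end

section \<open>The grid\<close>

text \<open>The potential of the shift argument. It is real-valued because a chord may point
  backwards and then has a negative increment.\<close>

definition level :: "vertex \<Rightarrow> real" where
  "level w = real (fst w) + real (snd w)"

lemma grid_sel [simp]:
  "tail (grid m n) = fst" "head (grid m n) = snd" "verts (grid m n) = {0..m} \<times> {0..n}"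
  by (simp_all add: grid_def)

lemma fin_digraph_grid: "fin_digraph (grid m n)"
proof -
  have v: "fst e \<in> {0..m} \<times> {0..n}" "snd e \<in> {0..m} \<times> {0..n}" if "e \<in> arcs (grid m n)" for e
    using that by (auto simp: grid_def)
  then have "arcs (grid m n) \<subseteq> ({0..m} \<times> {0..n}) \<times> ({0..m} \<times> {0..n})"
    by (metis mem_Times_iff subsetI)
  then have "finite (arcs (grid m n))"
    by (rule finite_subset) simp
  with v show ?thesis
    by unfold_locales simp_all
qed

lemma level_grid_arc: "e \<in> arcs (grid m n) \<Longrightarrow> level (snd e) - level (fst e) = 1"
  by (auto simp: grid_def level_def)

text \<open>Walk first along the side \<open>j = 0\<close> to \<open>(m, 0)\<close>, then along
  \<open>i = m\<close> to the sink, and shorten the walk to an \<open>apath\<close>.\<close>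

lemma st_paths_grid_nonempty: "st_paths (grid m n) (0, 0) (m, n) \<noteq> {}"
proof -
  interpret fin_digraph "grid m n" by (rule fin_digraph_grid)
  have row: "\<exists>p. awalk (0, 0) p (i, 0)" if "i \<le> m" for i
    using that
  proof (induction i)
    case (Suc i)
    then obtain p where "awalk (0, 0) p (i, 0)" by auto
    moreover have "awalk (i, 0) [((i, 0), (Suc i, 0))] (Suc i, 0)"
      using Suc by (auto simp: awalk_simps) (auto simp: grid_def)
    ultimately show ?case by (meson awalk_appendI)
  qed (auto simp: awalk_Nil_iff intro: exI[of _ "[]"])
  have "\<exists>p. awalk (0, 0) p (m, j)" if "j \<le> n" for j
    using that
  proof (induction j)
    case (Suc j)
    then obtain p where "awalk (0, 0) p (m, j)" by auto
    moreover have "awalk (m, j) [((m, j), (m, Suc j))] (m, Suc j)"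
      using Suc by (auto simp: awalk_simps) (auto simp: grid_def)
    ultimately show ?case by (meson awalk_appendI)
  qed (use row in auto)
  then obtain p where "awalk (0, 0) p (m, n)" by auto
  then have "apath (0, 0) (awalk_to_apath p) (m, n)" by (rule apath_awalk_to_apath)
  then show ?thesis unfolding st_paths_def by blast
qed

section \<open>The grid without a chord\<close>

locale braess_grid =
  fixes m n :: nat and a q :: real
  assumes dims: "1 \<le> m" and a: "0 < a" and q: "0 < q"
begin

lemma st_ne: "(0, 0) \<noteq> (m, n)"
  using dims by simp

sublocale fin_digraph "grid m n" by (rule fin_digraph_grid)

lemma grid_equilibrium_exists:
  "\<exists>f. is_user_equilibrium (grid m n) (grid_latency a b) (0, 0) (m, n) q f"
  using a q st_ne st_paths_grid_nonempty
  by (intro user_equilibrium_exists[where \<alpha> = "\<lambda>_. a" and \<beta> = "\<lambda>_. b"])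
    (auto simp: grid_latency_def)

lemma grid_equilibrium_cost:
  assumes "is_user_equilibrium (grid m n) (grid_latency a b) (0, 0) (m, n) q f"
  shows "equilibrium_cost (grid m n) (grid_latency a b) (0, 0) (m, n) q =
    flow_cost (grid m n) (grid_latency a b) f"
proof -
  \<comment> \<open>All slopes equal \<open>a > 0\<close>, so any pair with distinct ends can stand
    for the exceptional arc \<open>k\<close>.\<close>
  have "user_equilibrium (grid m n) (grid_latency a b) (0, 0) (m, n) q = f"
    using a q st_ne assms
    by (intro user_equilibrium_eqI[where \<alpha> = "\<lambda>_. a" and \<beta> = "\<lambda>_. b" and k = "((0, 0), (1, 0))"])
      (auto simp: grid_latency_def)
  then show ?thesis by (simp add: equilibrium_cost_def)
qed

text \<open>Each grid arc climbs one level, so every unit of demand uses exactly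
  \<open>m + n\<close> arcs. The \<open>b\<close>-part of the old cost is thereby fixed.\<close>

lemma grid_equilibrium_level:
  assumes "is_user_equilibrium (grid m n) (grid_latency a b) (0, 0) (m, n) q f"
  shows "sum f (arcs (grid m n)) = q * (m + n)"
  using user_equilibrium_potential[OF assms st_ne q, of level]
  by (simp add: level_grid_arc) (simp add: level_def)

lemma grid_flow_cost:
  assumes "is_user_equilibrium (grid m n) (grid_latency a b) (0, 0) (m, n) q f"
  shows "flow_cost (grid m n) (grid_latency a b) f =
    a * (\<Sum>e\<in>arcs (grid m n). (f e)\<^sup>2) + b * (q * (m + n))"
  unfolding grid_equilibrium_level[OF assms, symmetric]
  by (simp add: flow_cost_def grid_latency_def sum_distrib_left power2_eq_square algebra_simps
      sum.distrib)

end

section \<open>The grid with a chord added\<close>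

locale braess_chord = braess_grid +
  fixes u v :: vertex
  assumes chord: "is_chord m n u v"
begin

abbreviation "net \<equiv> pre_digraph.add_arc (grid m n) (u, v)"

lemma verts_net [simp]: "verts net = verts (grid m n)"
  using chord by (subst verts_add_arc) (auto simp: is_chord_def)

lemma net_sel [simp]: "arcs net = insert (u, v) (arcs (grid m n))" "tail net = fst" "head net = snd"
  by (simp_all add: add_arc_simps)

lemma chord_notin: "(u, v) \<notin> arcs (grid m n)" and chord_ne: "u \<noteq> v"
  using chord by (simp_all add: is_chord_def)

lemma fin_digraph_net: "fin_digraph net"
proof -
  have "wf_digraph net" by (rule wf_digraph_add_arc)
  then show ?thesis
    unfolding fin_digraph_def fin_digraph_axioms_def by simp
qed

sublocale N: fin_digraph net by (rule fin_digraph_net)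

lemma st_paths_subset: "st_paths (grid m n) s t \<subseteq> st_paths net s t"
proof -
  have "subgraph (grid m n) net"
    unfolding subgraph_def compatible_def using N.wf_digraph wf_digraph by auto
  then show ?thesis
    unfolding st_paths_def using N.subgraph_apath_imp_apath by blast
qed

lemma chord_equilibrium_exists:
  assumes "0 \<le> c"
  shows "\<exists>f. is_user_equilibrium net (chord_latency u v a b c d) (0, 0) (m, n) q f"
  using a q assms st_ne st_paths_grid_nonempty[of m n] st_paths_subset[of "(0, 0)" "(m, n)"]
  by (intro N.user_equilibrium_exists[where \<alpha> = "\<lambda>e. if e = (u, v) then c else a"
      and \<beta> = "\<lambda>e. if e = (u, v) then d else b"])
    (auto simp: chord_latency_def grid_latency_def)

lemma chord_equilibrium_cost:
  assumes "0 \<le> c" "is_user_equilibrium net (chord_latency u v a b c d) (0, 0) (m, n) q f"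
  shows "equilibrium_cost net (chord_latency u v a b c d) (0, 0) (m, n) q =
    flow_cost net (chord_latency u v a b c d) f"
proof -
  \<comment> \<open>The exceptional arc is now the chord, whose slope \<open>c\<close> may be
    zero.\<close>
  have "user_equilibrium net (chord_latency u v a b c d) (0, 0) (m, n) q = f"
    using a q st_ne assms chord_ne
    by (intro N.user_equilibrium_eqI[where \<alpha> = "\<lambda>e. if e = (u, v) then c else a"
      and \<beta> = "\<lambda>e. if e = (u, v) then d else b" and k = "(u, v)"])
      (auto simp: chord_latency_def grid_latency_def)
  then show ?thesis by (simp add: equilibrium_cost_def)
qed

lemma chord_latency_grid_arc:
  "e \<in> arcs (grid m n) \<Longrightarrow> chord_latency u v a b c d e x = a * x + b"
  using chord_notin by (auto simp: chord_latency_def grid_latency_def)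

text \<open>
  Testing the equilibrium of the augmented network against the old flow: a chord on which
  \<open>x (c x + d - b L) \<ge> 0\<close> does not raise the cost.
\<close>
lemma paradox_chord_cheap:
  fixes b c d :: real
  defines "l \<equiv> chord_latency u v a b c d"
  assumes f: "is_user_equilibrium net l (0, 0) (m, n) q f"
    and g: "is_user_equilibrium (grid m n) (grid_latency a b) (0, 0) (m, n) q g"
    and paradox: "flow_cost (grid m n) (grid_latency a b) g < flow_cost net l f"
  shows "f (u, v) * (c * f (u, v) + d - b * (level v - level u)) < 0"
proof -
  let ?E = "arcs (grid m n)" and ?x = "f (u, v)"
  \<comment> \<open>Inner products of the new flow \<open>f\<close> and the old flow
    \<open>g\<close> over the grid arcs only.\<close>
  define ff gf gg where "ff = (\<Sum>e\<in>?E. (f e)\<^sup>2)" and "gf = (\<Sum>e\<in>?E. g e * f e)"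
    and "gg = (\<Sum>e\<in>?E. (g e)\<^sup>2)"
  have lev: "?x * (level v - level u) + sum f ?E = q * (m + n)"
    using N.user_equilibrium_potential[OF f st_ne q, of level] chord_notin
    by (simp add: level_grid_arc) (simp add: level_def)
  have new: "flow_cost net l f = ?x * (c * ?x + d) + (a * ff + b * sum f ?E)"
    using chord_notin
    by (simp add: flow_cost_def l_def chord_latency_grid_arc ff_def sum_distrib_left sum.distrib
        power2_eq_square algebra_simps) (simp add: chord_latency_def algebra_simps)
  have "flow_cost net l f \<le> (\<Sum>e\<in>?E. g e * l e (f e))"
    using fin_digraph_net fin_digraph_grid st_paths_subset st_ne q f g
    by (rule user_equilibrium_variational)
  also have "\<dots> = a * gf + b * (q * (m + n))"
    unfolding grid_equilibrium_level[OF g, symmetric]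
    by (simp add: l_def chord_latency_grid_arc gf_def sum_distrib_left sum.distrib algebra_simps)
  finally have upper: "flow_cost net l f \<le> a * gf + b * (q * (m + n))" .
  have old: "flow_cost (grid m n) (grid_latency a b) g = a * gg + b * (q * (m + n))"
    unfolding gg_def by (rule grid_flow_cost[OF g])
  have "a * gg < a * gf" using paradox upper old by linarith
  then have "gg < gf" using a by simp
  \<comment> \<open>From \<open>2 * gf \<le> ff + gg\<close> and \<open>gg < gf\<close> follows
    \<open>gf < ff\<close>: the quadratic part of the new cost on the grid alone exceeds
    \<open>a * gf\<close>. The chord and the \<open>b\<close>-terms must make up for it.\<close>
  have "0 \<le> (\<Sum>e\<in>?E. (f e - g e)\<^sup>2)" by (intro sum_nonneg) auto
  also have "\<dots> = ff + gg - 2 * gf"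
    by (simp add: ff_def gg_def gf_def power2_diff sum.distrib sum_subtractf sum_distrib_left
        algebra_simps)
  finally have "gf < ff" using \<open>gg < gf\<close> by linarith
  then have "a * gf < a * ff" using a by simp
  with upper new have "?x * (c * ?x + d) + b * sum f ?E < b * (q * (m + n))" by linarith
  \<comment> \<open>Replacing \<open>q * (m + n)\<close> by its expression through the levels
    cancels \<open>b * sum f ?E\<close> and leaves the chord's share.\<close>
  then show ?thesis unfolding lev[symmetric] by (simp add: algebra_simps)
qed

section \<open>Replacing the chord by one of zero latency\<close>

lemma braess_ratio_eq:
  assumes "0 \<le> c" and "is_user_equilibrium net (chord_latency u v a b c d) (0, 0) (m, n) q f"
    and "is_user_equilibrium (grid m n) (grid_latency a b) (0, 0) (m, n) q g"
  shows "braess_ratio m n a q u v b c d =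
    flow_cost net (chord_latency u v a b c d) f / flow_cost (grid m n) (grid_latency a b) g"
  unfolding braess_ratio_def using assms by (simp add: grid_equilibrium_cost chord_equilibrium_cost)

lemma grid_flow_cost_pos:
  assumes "is_user_equilibrium (grid m n) (grid_latency a b) (0, 0) (m, n) q g" "0 < b"
  shows "0 < flow_cost (grid m n) (grid_latency a b) g"
  unfolding grid_flow_cost[OF assms(1)] using a q dims assms(2)
  by (intro add_nonneg_pos mult_nonneg_nonneg sum_nonneg mult_pos_pos) auto

lemma zero_latency_chord_better:
  assumes "0 \<le> b" "0 \<le> c" "0 \<le> d" "1 < braess_ratio m n a q u v b c d" "c \<noteq> 0 \<or> d \<noteq> 0"
  shows "\<exists>b'\<ge>0. braess_ratio m n a q u v b c d < braess_ratio m n a q u v b' 0 0"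
proof -
  let ?l = "chord_latency u v a b c d"
  obtain f where f: "is_user_equilibrium net ?l (0, 0) (m, n) q f"
    using chord_equilibrium_exists \<open>0 \<le> c\<close> by blast
  obtain g where g: "is_user_equilibrium (grid m n) (grid_latency a b) (0, 0) (m, n) q g"
    using grid_equilibrium_exists by blast
  define x L where "x = f (u, v)" and "L = level v - level u"
  define A B where "A = flow_cost net ?l f" and "B = flow_cost (grid m n) (grid_latency a b) g"
  have ratio: "braess_ratio m n a q u v b c d = A / B"
    unfolding A_def B_def using \<open>0 \<le> c\<close> f g by (rule braess_ratio_eq)
  have "0 \<le> B" unfolding B_def grid_flow_cost[OF g] using a q \<open>0 \<le> b\<close>
    by (intro add_nonneg_nonneg mult_nonneg_nonneg sum_nonneg) auto
  \<comment> \<open>Division by zero yields 0, so a ratio above 1 rules out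
    \<open>B = 0\<close>.\<close>
  with assms(4) ratio have "0 < B" by (cases "B = 0") auto
  with assms(4) ratio have "B < A" by simp
  then have "x * (c * x + d - b * L) < 0"
    using paradox_chord_cheap[OF f g] by (simp add: A_def B_def x_def L_def)
  moreover have "0 \<le> x"
    using f by (auto simp: x_def is_user_equilibrium_def feasible_flow_def)
  ultimately have "0 < x" "c * x + d < b * L"
    by (auto simp: mult_less_0_iff)
  moreover have "0 \<le> c * x" using \<open>0 \<le> c\<close> \<open>0 \<le> x\<close> by simp
  ultimately have "0 < b * L" using \<open>0 \<le> d\<close> by linarith
  then have "0 < L" using \<open>0 \<le> b\<close> by (simp add: zero_less_mult_iff)
  \<comment> \<open>The shift that brings the chord's latency at its equilibrium flow
    \<open>x\<close> to exactly zero.\<close>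
  define \<delta> where "\<delta> = (c * x + d) / L"
  \<comment> \<open>If only \<open>c\<close> is nonzero, positivity comes from \<open>0 < x\<close>:
    the chord is really used.\<close>
  have "0 < c * x + d"
    using assms(2,3,5) \<open>0 < x\<close> by (metis add_nonneg_pos add_pos_nonneg less_le mult_pos_pos mult_nonneg_nonneg)
  then have "0 < \<delta>" using \<open>0 < L\<close> by (simp add: \<delta>_def)
  have "\<delta> < b" using \<open>c * x + d < b * L\<close> \<open>0 < L\<close> by (simp add: \<delta>_def field_simps)
  let ?l' = "chord_latency u v a (b - \<delta>) 0 0"
  \<comment> \<open>On the chord this is an identity at the value \<open>x\<close>, not of latency
    functions: \<open>c * x + d - \<delta> * L = 0\<close>.\<close>
  have chord_shift: "?l' e (f e) = ?l e (f e) - \<delta> * (level (head net e) - level (tail net e))"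
    if "e \<in> arcs net" for e
  proof (cases "e = (u, v)")
    case True
    then show ?thesis using \<open>0 < L\<close> by (simp add: chord_latency_def \<delta>_def x_def L_def)
  next
    case False
    then show ?thesis using that by (simp add: chord_latency_grid_arc level_grid_arc)
  qed
  have grid_shift: "grid_latency a (b - \<delta>) e (g e) = grid_latency a b e (g e) -
      \<delta> * (level (head (grid m n) e) - level (tail (grid m n) e))" if "e \<in> arcs (grid m n)" for e
    using that by (simp add: grid_latency_def level_grid_arc)
  have f': "is_user_equilibrium net ?l' (0, 0) (m, n) q f"
    using f chord_shift by (rule N.user_equilibrium_shift)
  have g': "is_user_equilibrium (grid m n) (grid_latency a (b - \<delta>)) (0, 0) (m, n) q g"
    using g grid_shift by (rule user_equilibrium_shift)
  define K where "K = \<delta> * (q * (level (m, n) - level (0, 0)))"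
  have "0 < K" using \<open>0 < \<delta>\<close> q dims by (simp add: K_def level_def)
  have cost: "flow_cost net ?l' f = A - K"
    unfolding A_def K_def using f st_ne q chord_shift by (rule N.flow_cost_shift)
  have cost': "flow_cost (grid m n) (grid_latency a (b - \<delta>)) g = B - K"
    unfolding B_def K_def using g st_ne q grid_shift by (rule flow_cost_shift)
  have "0 < B - K" using grid_flow_cost_pos[OF g'] \<open>\<delta> < b\<close> cost' by simp
  \<comment> \<open>Subtracting the same positive \<open>K\<close> from both costs raises a ratio
    above 1 as long as the denominator stays positive, which \<open>\<delta> < b\<close>
    ensures.\<close>
  have "A / B < (A - K) / (B - K)"
    using \<open>0 < B\<close> \<open>0 < B - K\<close> \<open>B < A\<close> \<open>0 < K\<close> by (simp add: field_simps)
  also have "\<dots> = braess_ratio m n a q u v (b - \<delta>) 0 0"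
    using braess_ratio_eq[OF _ f' g'] cost cost' by simp
  finally show ?thesis using ratio \<open>\<delta> < b\<close> by (intro exI[of _ "b - \<delta>"]) simp
qed

end

theorem theorem4p3:
  fixes m n :: nat and a q b c d :: real and u v :: vertex
  assumes "m \<ge> 1" and "n \<ge> 1" and "a > 0" and "q > 0"
    and capable: "\<exists>u' v' b' c' d'. is_chord m n u' v' \<and> b' \<ge> 0 \<and> c' \<ge> 0 \<and> d' \<ge> 0 \<and>
          braess_ratio m n a q u' v' b' c' d' > 1"
    and "is_chord m n u v" and "b \<ge> 0" and "c \<ge> 0" and "d \<ge> 0"
    and maximal: "\<forall>u' v' b' c' d'. is_chord m n u' v' \<and> b' \<ge> 0 \<and> c' \<ge> 0 \<and> d' \<ge> 0 \<longrightarrow>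
          braess_ratio m n a q u' v' b' c' d' \<le> braess_ratio m n a q u v b c d"
  shows "c = 0 \<and> d = 0"
proof (rule ccontr)
  assume "\<not> (c = 0 \<and> d = 0)"
  interpret braess_chord m n a q u v
    using assms by unfold_locales auto
  \<comment> \<open>The maximum is at least the ratio of the paradoxical chord given by
    \<open>capable\<close>.\<close>
  have "1 < braess_ratio m n a q u v b c d"
    using capable maximal by fastforce
  then obtain b' where "0 \<le> b'" "braess_ratio m n a q u v b c d < braess_ratio m n a q u v b' 0 0"
    using zero_latency_chord_better[of b c d] \<open>\<not> (c = 0 \<and> d = 0)\<close> assms(7-9) by blast
  then show False
    using maximal \<open>is_chord m n u v\<close> by (metis leD order_refl)
qed

end
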